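(* Let $d,m,T\ge 1$ be integers, let $U=(u_1,\dots,u_m)$ with $u_j\in\mathbb{S}^{d-1}=\{u\in\mathbb{R}^d:\|u\|_2=1\}$, and let $\Gamma=[\gamma_{t,j}]\in\mathbb{R}^{T\times m}$. Suppose that the only $\dot U=(\dot u_1,\dots,\dot u_m)\in(\mathbb{R}^d)^m$ with $u_j^\top\dot u_j=0$ for $j=1,\dots,m$, and $\dot\Gamma=[\dot\gamma_{t,j}]\in\mathbb{R}^{T\times m}$, satisfying $$\sum_{j=1}^{m}\Big[\dot\gamma_{t,j}\,u_ju_j^\top+\gamma_{t,j}\big(\dot u_ju_j^\top+u_j\dot u_j^\top\big)\Big]=0\qquad\text{for all } t=1,\dots,T$$ are $\dot U=0$ and $\dot\Gamma=0$. Then the restricted differential $J_{\mathrm{res}}(U,\Gamma)$ is injective, and the factorization $H_t=\sum_{j=1}^m\gamma_{t,j}u_ju_j^\top$, $t=1,\dots,T$, is locally identifiable up to simultaneous permutation of the atom--coefficient pairs $(u_j,\Gamma_{\cdot,j})$ and sign changes $u_j\mapsto -u_j$.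
   Context: For $U=(u_1,\dots,u_m)\in(\mathbb{S}^{d-1})^m$ and $\Gamma\in\mathbb{R}^{T\times m}$ define $\Psi_t(U,\Gamma)=\sum_{j=1}^m\gamma_{t,j}u_ju_j^\top$ and $\Psi(U,\Gamma)=(\Psi_1(U,\Gamma),\dots,\Psi_T(U,\Gamma))$, a map into $T$-tuples of symmetric $d\times d$ real matrices. $J_{\mathrm{res}}(U,\Gamma)$ denotes the differential of $\Psi$ at $(U,\Gamma)$ restricted to tangent perturbations of the spheres, i.e. the linear map sending $(\dot U,\dot\Gamma)$, with $u_j^\top\dot u_j=0$ for all $j$ and $\dot\Gamma\in\mathbb{R}^{T\times m}$ arbitrary, to the $T$-tuple with $t$-th entry $\sum_j[\dot\gamma_{t,j}u_ju_j^\top+\gamma_{t,j}(\dot u_ju_j^\top+u_j\dot u_j^\top)]$. "Locally identifiable up to simultaneous permutation and sign changes" means: there is a neighborhood $\mathcal{N}$ of $(U,\Gamma)$ in $(\mathbb{S}^{d-1})^m\times\mathbb{R}^{T\times m}$ on which $\Psi$ is one-to-one, so that any two factorizations in $\mathcal{N}$ producing the same tuple of matrices coincide. The only ambiguities admitted outside this are the discrete symmetries $(u_j,\Gamma_{\cdot,j})_j\mapsto(\sigma_ju_{\pi(j)},\Gamma_{\cdot,\pi(j)})_j$, with $\pi$ a permutation of $\{1,\dots,m\}$ and $\sigma\in\{\pm1\}^m$, which leave $\Psi$ unchanged. *)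

theory Defs
  imports "HOL-Analysis.Analysis"
begin

text \<open>
  The integers \<open>d, m, T \<ge> 1\<close> are the cardinalities of the finite index types \<open>'d\<close>, \<open>'m\<close>, \<open>'t\<close>.
  A factorization is a pair \<open>(U, \<Gamma>)\<close> where \<open>U $ j\<close> is the atom \<open>u\<^sub>j\<close> and
  \<open>\<Gamma> $ t $ j\<close> is the coefficient \<open>\<gamma>\<^sub>t\<^sub>,\<^sub>j\<close>.
\<close>

type_synonym ('d, 'm, 't) factorization = "((real ^ 'd) ^ 'm) \<times> (real ^ 'm ^ 't)"

definition outer :: "real ^ 'd \<Rightarrow> real ^ 'd \<Rightarrow> real ^ 'd ^ 'd" where
  "outer x y = (\<chi> a b. x $ a * y $ b)"

lemma outer_eq_matrix_mult:
  "outer x y = (columnvector x :: real ^ 1 ^ 'd) ** (rowvector y :: real ^ 'd ^ 1)"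
  by (simp add: outer_def matrix_matrix_mult_def columnvector_def rowvector_def vec_eq_iff)

definition Psi :: "('d::finite, 'm::finite, 't::finite) factorization \<Rightarrow> (real ^ 'd ^ 'd) ^ 't" where
  "Psi = (\<lambda>(U, \<Gamma>). \<chi> t. \<Sum>j\<in>UNIV. (\<Gamma> $ t $ j) *\<^sub>R outer (U $ j) (U $ j))"

lemma transpose_Psi: "transpose (Psi p $ t) = Psi p $ t"
  by (simp add: Psi_def outer_def transpose_def vec_eq_iff case_prod_beta mult.commute)

definition factorizations :: "('d::finite, 'm::finite, 't::finite) factorization set" where
  "factorizations = {U. \<forall>j. U $ j \<in> sphere 0 1} \<times> UNIV"

definition tangent_perturbations ::
    "(real ^ 'd) ^ 'm \<Rightarrow> ('d::finite, 'm::finite, 't::finite) factorization set" where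
  "tangent_perturbations U = {V. \<forall>j. U $ j \<bullet> V $ j = 0} \<times> UNIV"

definition J_res ::
    "('d::finite, 'm::finite, 't::finite) factorization \<Rightarrow>
     ('d, 'm, 't) factorization \<Rightarrow> (real ^ 'd ^ 'd) ^ 't" where
  "J_res p = restrict (frechet_derivative Psi (at p)) (tangent_perturbations (fst p))"

lemma bounded_bilinear_outer: "bounded_bilinear outer"
proof -
  have "bilinear (outer :: real ^ 'd \<Rightarrow> _)"
    by (auto simp: bilinear_def outer_def vec_eq_iff algebra_simps intro!: linearI)
  then show ?thesis
    by (simp add: bilinear_conv_bounded_bilinear)
qed

lemma Psi_has_derivative:
  fixes U :: "(real ^ 'd::finite) ^ 'm::finite" and \<Gamma> :: "real ^ 'm ^ 't::finite"
  shows "(Psi has_derivative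
          (\<lambda>(V, \<Delta>). \<chi> t. \<Sum>j\<in>UNIV.
             (\<Delta> $ t $ j) *\<^sub>R outer (U $ j) (U $ j)
             + (\<Gamma> $ t $ j) *\<^sub>R (outer (V $ j) (U $ j) + outer (U $ j) (V $ j)))) (at (U, \<Gamma>))"
proof -
  note [derivative_intros] = bounded_bilinear.FDERIV[OF bounded_bilinear_outer]
  have nth [derivative_intros]: "((\<lambda>x. f x $ i) has_derivative (\<lambda>x. f' x $ i)) F"
    if "(f has_derivative f') F"
    for f :: "'z::real_normed_vector \<Rightarrow> ('y::real_normed_vector) ^ 'n::finite" and f' i F
    by (rule bounded_linear.has_derivative[OF bounded_linear_vec_nth that])
  have vec: "((\<lambda>x. \<chi> t. f t x) has_derivative (\<lambda>h. \<chi> t. f' t h)) (at a)"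
    if "\<And>t::'t. (f t has_derivative f' t) (at a)"
    for f :: "'t \<Rightarrow> ('d, 'm, 't) factorization \<Rightarrow> real ^ 'd ^ 'd" and f' a
    unfolding has_derivative_componentwise_within[of "\<lambda>x. \<chi> t. f t x"]
    by (auto simp: Basis_vec_def inner_axis intro!: has_derivative_inner_left nth that)
  show ?thesis
    unfolding Psi_def case_prod_beta
    apply (rule vec)
    apply (rule derivative_eq_intros refl | simp)+
    apply (auto simp: fun_eq_iff algebra_simps)
    done
qed

lemma J_res_apply:
  fixes U :: "(real ^ 'd::finite) ^ 'm::finite" and \<Gamma> :: "real ^ 'm ^ 't::finite"
  assumes "\<forall>j. U $ j \<bullet> V $ j = 0"
  shows "J_res (U, \<Gamma>) (V, \<Delta>) = (\<chi> t. \<Sum>j\<in>UNIV.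
           (\<Delta> $ t $ j) *\<^sub>R outer (U $ j) (U $ j)
           + (\<Gamma> $ t $ j) *\<^sub>R (outer (V $ j) (U $ j) + outer (U $ j) (V $ j)))"
  using assms frechet_derivative_at[OF Psi_has_derivative, of U \<Gamma>, symmetric]
  by (simp add: J_res_def tangent_perturbations_def)

definition symmetry :: "('m \<Rightarrow> 'm) \<Rightarrow> ('m \<Rightarrow> real) \<Rightarrow>
    ('d::finite, 'm::finite, 't::finite) factorization \<Rightarrow> ('d, 'm, 't) factorization" where
  "symmetry \<pi> \<sigma> = (\<lambda>(U, \<Gamma>). (\<chi> j. \<sigma> j *\<^sub>R U $ \<pi> j, \<chi> t j. \<Gamma> $ t $ \<pi> j))"

definition symmetries ::
    "(('d::finite, 'm::finite, 't::finite) factorization \<Rightarrow> ('d, 'm, 't) factorization) set" where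
  "symmetries = {symmetry \<pi> \<sigma> | \<pi> \<sigma>. \<pi> permutes UNIV \<and> range \<sigma> \<subseteq> {-1, 1}}"

lemma Psi_symmetry:
  fixes p :: "('d::finite, 'm::finite, 't::finite) factorization"
  assumes "g \<in> symmetries"
  shows "Psi (g p) = Psi p"
proof -
  obtain \<pi> \<sigma> where g: "g = symmetry \<pi> \<sigma>" and \<pi>: "\<pi> permutes (UNIV :: 'm set)"
    and \<sigma>: "range \<sigma> \<subseteq> {-1, 1}"
    using assms by (auto simp: symmetries_def)
  obtain U \<Gamma> where p: "p = (U, \<Gamma>)"
    by (cases p)
  have "outer (\<sigma> j *\<^sub>R x) (\<sigma> j *\<^sub>R x) = outer x x" for j and x :: "real ^ 'd"
  proof -
    have "\<sigma> j * \<sigma> j = 1"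
      using \<sigma> by (metis insertE mult_1 mult_minus_left rangeI singletonD subsetD minus_minus)
    then show ?thesis
      by (simp add: outer_def vec_eq_iff algebra_simps)
  qed
  moreover have "(\<Sum>j\<in>UNIV. \<Gamma> $ t $ \<pi> j *\<^sub>R outer (U $ \<pi> j) (U $ \<pi> j)) =
      (\<Sum>j\<in>UNIV. \<Gamma> $ t $ j *\<^sub>R outer (U $ j) (U $ j))" for t
    by (rule sum.permute[OF \<pi>, unfolded o_def, symmetric])
  ultimately show ?thesis
    by (simp add: g p symmetry_def Psi_def)
qed

text \<open>
  \<open>Psi\<close> is one-to-one on a neighborhood \<open>N\<close> of \<open>p\<close> in the product of spheres with the coefficient
  space; and among the copies of \<open>N\<close> under the discrete symmetries, two factorizations give the
  same tuple of matrices exactly when a discrete symmetry relates them.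
\<close>

definition locally_identifiable ::
    "('d::finite, 'm::finite, 't::finite) factorization \<Rightarrow> bool" where
  "locally_identifiable p \<longleftrightarrow>
     (\<exists>N. openin (top_of_set factorizations) N \<and> p \<in> N \<and> inj_on Psi N \<and>
          (\<forall>x\<in>(\<Union>g\<in>symmetries. g ` N). \<forall>y\<in>(\<Union>g\<in>symmetries. g ` N).
             Psi x = Psi y \<longleftrightarrow> (\<exists>g\<in>symmetries. y = g x)))"

end

theory Submission
  imports Defs
begin

text \<open>
  Append the squared norms of the atoms to the matrices. The kernel of the differential of the
  augmented map consists of tangent perturbations only, so by nondegeneracy this differential is
  injective on the whole ambient space and the augmented map is injective near the given point.
  On the product of spheres the added components are constant, so injectivity
  passes to the map without them.
\<close>

text \<open>A symmetry reindexes by precomposition, so permutations compose in reverse order, and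
  the inner signs \<open>\<tau>\<close> are read off at the index \<open>\<pi> j\<close> already
  moved by the outer permutation.\<close>

lemma symmetry_comp:
  "symmetry \<pi> \<sigma> (symmetry \<rho> \<tau> p) = symmetry (\<rho> \<circ> \<pi>) (\<lambda>j. \<sigma> j * \<tau> (\<pi> j)) p"
  by (simp add: symmetry_def vec_eq_iff split: prod.split)

lemma symmetries_comp:
  assumes "g \<in> symmetries" "h \<in> symmetries"
  shows "g \<circ> h \<in> symmetries"
proof -
  obtain \<pi> \<sigma> where g: "g = symmetry \<pi> \<sigma>" "\<pi> permutes UNIV" "range \<sigma> \<subseteq> {-1, 1}"
    using assms(1) by (auto simp: symmetries_def)
  obtain \<rho> \<tau> where h: "h = symmetry \<rho> \<tau>" "\<rho> permutes UNIV" "range \<tau> \<subseteq> {-1, 1}"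
    using assms(2) by (auto simp: symmetries_def)
  have "g \<circ> h = symmetry (\<rho> \<circ> \<pi>) (\<lambda>j. \<sigma> j * \<tau> (\<pi> j))"
    by (simp add: g h symmetry_comp fun_eq_iff)
  moreover have "(\<rho> \<circ> \<pi>) permutes UNIV"
    using g h by (simp add: permutes_compose)
  moreover have "\<sigma> j * \<tau> (\<pi> j) \<in> {-1, 1}" for j
  proof -
    have "\<sigma> j \<in> {-1, 1}" "\<tau> (\<pi> j) \<in> {-1, 1}"
      using g(3) h(3) by auto
    then show ?thesis
      by auto
  qed
  ultimately show ?thesis
    unfolding symmetries_def by blast
qed

lemma symmetries_inverse:
  fixes g :: "('d::finite, 'm::finite, 't::finite) factorization \<Rightarrow> ('d, 'm, 't) factorization"
  assumes "g \<in> symmetries"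
  obtains h :: "('d, 'm, 't) factorization \<Rightarrow> ('d, 'm, 't) factorization"
  where "h \<in> symmetries" "\<And>p. h (g p) = p"
proof -
  obtain \<pi> \<sigma> where g: "g = symmetry \<pi> \<sigma>" and \<pi>: "\<pi> permutes UNIV" and \<sigma>: "range \<sigma> \<subseteq> {-1, 1}"
    using assms by (auto simp: symmetries_def)
  define h :: "('d, 'm, 't) factorization \<Rightarrow> ('d, 'm, 't) factorization"
    \<comment> \<open>A sign is its own inverse. Shifting the signs by \<open>inv \<pi>\<close>
      makes each sign factor of \<open>h \<circ> g\<close> a square, hence 1.\<close>
    where "h = symmetry (inv \<pi>) (\<lambda>j. \<sigma> (inv \<pi> j))"
  have sq: "\<sigma> j * \<sigma> j = 1" for j
  proof -
    have "\<sigma> j \<in> {-1, 1}"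
      using \<sigma> by auto
    then show ?thesis
      by auto
  qed
  have "h (g p) = p" for p
    using permutes_inv_o[OF \<pi>]
    by (cases p) (simp add: h_def g symmetry_comp sq, simp add: symmetry_def)
  moreover have "h \<in> symmetries"
    using permutes_inv[OF \<pi>] \<sigma> unfolding h_def symmetries_def by blast
  ultimately show ?thesis
    using that by blast
qed

text \<open>The clause on symmetric copies of \<open>N\<close> comes for free: by invariance of
  \<open>Psi\<close>, points \<open>g a\<close> and \<open>h b\<close> with equal images pull back
  to \<open>a\<close> and \<open>b\<close> in \<open>N\<close> with equal images. Hence
  \<open>a = b\<close>, and \<open>h\<close> composed with the inverse of \<open>g\<close> carries
  one point to the other.\<close>

lemma locally_identifiable_if_inj_on:
  assumes "openin (top_of_set factorizations) N" "p \<in> N" and inj: "inj_on Psi N"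
  shows "locally_identifiable p"
  unfolding locally_identifiable_def
proof (intro exI conjI ballI)
  fix x y
  assume "x \<in> (\<Union>g\<in>symmetries. g ` N)" "y \<in> (\<Union>g\<in>symmetries. g ` N)"
  then obtain g h a b where gh: "g \<in> symmetries" "h \<in> symmetries" and ab: "a \<in> N" "b \<in> N"
    and x: "x = g a" and y: "y = h b"
    by blast
  obtain g' where g': "g' \<in> symmetries" "\<And>p. g' (g p) = p"
    using symmetries_inverse[OF gh(1)] by blast
  show "Psi x = Psi y \<longleftrightarrow> (\<exists>g\<in>symmetries. y = g x)"
  proof
    assume "Psi x = Psi y"
    then have "Psi a = Psi b"
      using gh by (simp add: x y Psi_symmetry)
    then have "a = b"
      using inj ab by (auto dest: inj_onD)
    then have "y = (h \<circ> g') x"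
      by (simp add: x y g')
    then show "\<exists>g\<in>symmetries. y = g x"
      using symmetries_comp[OF gh(2) g'(1)] by blast
  qed (auto simp: Psi_symmetry)
qed (use assms in auto)

text \<open>The differential without restriction to tangent directions, as a function of the base
  point too, so that its continuity in the base point can be stated.\<close>

definition dPsi ::
    "('d::finite, 'm::finite, 't::finite) factorization \<Rightarrow>
     ('d, 'm, 't) factorization \<Rightarrow> (real ^ 'd ^ 'd) ^ 't" where
  "dPsi = (\<lambda>(U, \<Gamma>) (V, \<Delta>). \<chi> t. \<Sum>j\<in>UNIV.
     (\<Delta> $ t $ j) *\<^sub>R outer (U $ j) (U $ j)
     + (\<Gamma> $ t $ j) *\<^sub>R (outer (V $ j) (U $ j) + outer (U $ j) (V $ j)))"

lemma Psi_has_derivative_dPsi: "(Psi has_derivative dPsi p) (at p)"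
  using Psi_has_derivative[of "fst p" "snd p"] by (simp add: dPsi_def case_prod_beta)

lemma linear_dPsi: "linear (dPsi p)"
  using Psi_has_derivative_dPsi by (rule has_derivative_linear)

lemma continuous_on_dPsi: "continuous_on S (\<lambda>x. dPsi x v)"
  unfolding dPsi_def case_prod_beta
  by (intro continuous_intros bounded_bilinear.continuous_on[OF bounded_bilinear_outer])

text \<open>Squared norms keep the map polynomial, so it is differentiable even where an atom
  vanishes.\<close>

definition normed_Psi ::
    "('d::finite, 'm::finite, 't::finite) factorization \<Rightarrow>
     ((real ^ 'd ^ 'd) ^ 't) \<times> (real ^ 'm)" where
  "normed_Psi p = (Psi p, \<chi> j. fst p $ j \<bullet> fst p $ j)"

definition dnormed_Psi ::
    "('d::finite, 'm::finite, 't::finite) factorization \<Rightarrow>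
     ('d, 'm, 't) factorization \<Rightarrow> ((real ^ 'd ^ 'd) ^ 't) \<times> (real ^ 'm)" where
  "dnormed_Psi p v = (dPsi p v, \<chi> j. 2 * (fst p $ j \<bullet> fst v $ j))"

lemma normed_Psi_has_derivative: "(normed_Psi has_derivative dnormed_Psi p) (at p)"
proof -
  have nth: "((\<lambda>x. fst x $ j) has_derivative (\<lambda>x. fst x $ j)) (at p)" for j
    by (intro bounded_linear_imp_has_derivative
        bounded_linear_compose[OF bounded_linear_vec_nth bounded_linear_fst])
  have "((\<lambda>x. fst x $ j \<bullet> fst x $ j) has_derivative (\<lambda>v. 2 * (fst p $ j \<bullet> fst v $ j))) (at p)" for j
    using has_derivative_inner[OF nth[of j] nth[of j]] by (simp add: inner_commute)
  then have "((\<lambda>x. \<chi> j. fst x $ j \<bullet> fst x $ j) has_derivative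
      (\<lambda>v. \<chi> j. 2 * (fst p $ j \<bullet> fst v $ j))) (at p)"
    unfolding has_derivative_componentwise_within[of "\<lambda>x. \<chi> j. fst x $ j \<bullet> fst x $ j"]
    by (auto simp: Basis_vec_def inner_axis)
  from has_derivative_Pair[OF Psi_has_derivative_dPsi this] show ?thesis
    by (simp add: normed_Psi_def[abs_def] dnormed_Psi_def[abs_def])
qed

lemma linear_dnormed_Psi: "linear (dnormed_Psi p)"
  using normed_Psi_has_derivative by (rule has_derivative_linear)

lemma continuous_on_dnormed_Psi: "continuous_on S (\<lambda>x. dnormed_Psi x v)"
  unfolding dnormed_Psi_def by (intro continuous_intros continuous_on_dPsi)

text \<open>In finite dimension the operator norm is at most the sum of the norms of the images of
  the basis vectors, so pointwise continuity of \<open>f'\<close> gives continuity in operator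
  norm.\<close>

lemma onorm_diff_tendsto:
  fixes f' :: "'a::t2_space \<Rightarrow> 'n::euclidean_space \<Rightarrow> 'k::euclidean_space"
  assumes lin: "\<And>x. linear (f' x)" and cont: "\<And>v. continuous_on UNIV (\<lambda>x. f' x v)"
  shows "((\<lambda>x. onorm (\<lambda>v. f' x v - f' a v)) \<longlongrightarrow> 0) (at a)"
proof (rule tendsto_sandwich)
  have bl: "bounded_linear (\<lambda>v. f' x v - f' a v)" for x
    using lin by (intro bounded_linear_sub) (simp_all add: linear_conv_bounded_linear)
  show "\<forall>\<^sub>F x in at a. 0 \<le> onorm (\<lambda>v. f' x v - f' a v)"
    by (simp add: onorm_pos_le[OF bl])
  show "\<forall>\<^sub>F x in at a. onorm (\<lambda>v. f' x v - f' a v) \<le> (\<Sum>b\<in>Basis. norm (f' x b - f' a b))"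
    by (simp add: onorm_componentwise[OF bl])
  have "((\<lambda>x. \<Sum>b\<in>Basis. norm (f' x b - f' a b)) \<longlongrightarrow> (\<Sum>b\<in>(Basis::'n set). norm (f' a b - f' a b))) (at a)"
    using cont by (intro tendsto_intros) (simp add: continuous_on_def)
  then show "((\<lambda>x. \<Sum>b\<in>Basis. norm (f' x b - f' a b)) \<longlongrightarrow> 0) (at a)"
    by simp
qed auto

text \<open>This is the injectivity half of the inverse function theorem. A left inverse of the
  derivative suffices, so domain and codomain may differ in dimension.\<close>

lemma normed_Psi_locally_inj:
  assumes "inj (dnormed_Psi p)"
  obtains r where "r > 0" "inj_on normed_Psi (ball p r)"
proof -
  obtain g where g: "linear g" "g \<circ> dnormed_Psi p = id"
    using linear_injective_left_inverse[OF linear_dnormed_Psi assms] by blast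
  have *: "\<exists>d>0. \<forall>x. dist p x < d \<longrightarrow> onorm (\<lambda>v. dnormed_Psi x v - dnormed_Psi p v) < e"
    if "e > 0" for e
  proof -
    have "\<forall>\<^sub>F x in at p. dist (onorm (\<lambda>v. dnormed_Psi x v - dnormed_Psi p v)) 0 < e"
      by (rule tendstoD[OF onorm_diff_tendsto that])
        (rule linear_dnormed_Psi continuous_on_dnormed_Psi)+
    then obtain d where "d > 0"
      and d: "\<And>x. x \<noteq> p \<Longrightarrow> dist x p < d \<Longrightarrow>
        dist (onorm (\<lambda>v. dnormed_Psi x v - dnormed_Psi p v)) 0 < e"
      by (auto simp: eventually_at)
    \<comment> \<open>The punctured limit leaves out \<open>x = p\<close>, where the difference is
      the zero map.\<close>
    have "onorm (\<lambda>v. dnormed_Psi x v - dnormed_Psi p v) < e" if "dist p x < d" for x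
      using d[of x] that \<open>e > 0\<close> by (cases "x = p") (auto simp: onorm_zero dist_commute)
    then show ?thesis
      using \<open>d > 0\<close> by blast
  qed
  show ?thesis
    by (rule has_derivative_locally_injective[of p UNIV g dnormed_Psi normed_Psi])
      (use g * normed_Psi_has_derivative that in \<open>auto simp: linear_conv_bounded_linear\<close>)
qed

theorem theorem1:
  fixes U :: "(real ^ 'd::finite) ^ 'm::finite" and \<Gamma> :: "real ^ 'm ^ 't::finite"
  assumes unit: "\<forall>j. U $ j \<in> sphere 0 1"
    and nondegenerate: "\<forall>(V :: (real ^ 'd) ^ 'm) (\<Delta> :: real ^ 'm ^ 't).
      (\<forall>j. U $ j \<bullet> V $ j = 0) \<longrightarrow>
      (\<forall>t. (\<Sum>j\<in>UNIV.
         (\<Delta> $ t $ j) *\<^sub>R outer (U $ j) (U $ j)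
         + (\<Gamma> $ t $ j) *\<^sub>R (outer (V $ j) (U $ j) + outer (U $ j) (V $ j))) = 0) \<longrightarrow>
      V = 0 \<and> \<Delta> = 0"
  shows "inj_on (J_res (U, \<Gamma>)) (tangent_perturbations U) \<and> locally_identifiable (U, \<Gamma>)"
proof
  \<comment> \<open>Nondegeneracy as a kernel statement, used both for \<open>J_res\<close> and for
    the augmented differential.\<close>
  have ker: "v = 0" if "\<forall>j. U $ j \<bullet> fst v $ j = 0" "dPsi (U, \<Gamma>) v = 0" for v
  proof -
    have "\<forall>t. dPsi (U, \<Gamma>) v $ t = 0"
      using that(2) by simp
    then have "fst v = 0 \<and> snd v = 0"
      using nondegenerate[rule_format, OF that(1)[rule_format], of "snd v"]
      unfolding dPsi_def case_prod_beta by simp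
    then show ?thesis
      by (simp add: prod_eq_iff)
  qed
  \<comment> \<open>\<open>J_res\<close> has the value \<open>undefined\<close> off the tangent
    space, so linearity is taken from \<open>dPsi\<close>.\<close>
  have J_res_eq: "J_res (U, \<Gamma>) v = dPsi (U, \<Gamma>) v" if "v \<in> tangent_perturbations U" for v
  proof -
    have "\<forall>j. U $ j \<bullet> fst v $ j = 0"
      using that by (auto simp: tangent_perturbations_def)
    from J_res_apply[OF this, of \<Gamma> "snd v"] show ?thesis
      by (simp add: dPsi_def case_prod_beta)
  qed
  show "inj_on (J_res (U, \<Gamma>)) (tangent_perturbations U)"
  proof (rule inj_onI)
    fix v w
    assume vw: "v \<in> tangent_perturbations U" "w \<in> tangent_perturbations U"
      and "J_res (U, \<Gamma>) v = J_res (U, \<Gamma>) w"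
    then have "dPsi (U, \<Gamma>) (v - w) = 0"
      by (simp add: J_res_eq linear_diff[OF linear_dPsi])
    moreover have "\<forall>j. U $ j \<bullet> fst (v - w) $ j = 0"
      using vw by (auto simp: tangent_perturbations_def inner_diff_right)
    ultimately have "v - w = 0"
      by (intro ker)
    then show "v = w"
      by simp
  qed
  have "v = 0" if "dnormed_Psi (U, \<Gamma>) v = 0" for v
  proof (rule ker)
    show "dPsi (U, \<Gamma>) v = 0"
      using that by (simp add: dnormed_Psi_def prod_eq_iff)
    \<comment> \<open>The appended components of the differential are twice the radial parts of
      \<open>v\<close>; their vanishing is tangency.\<close>
    have "(\<chi> j. 2 * (U $ j \<bullet> fst v $ j)) $ j = 0" for j
      using that by (simp add: dnormed_Psi_def prod_eq_iff)
    then show "\<forall>j. U $ j \<bullet> fst v $ j = 0"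
      by simp
  qed
  then have "inj (dnormed_Psi (U, \<Gamma>))"
    by (simp add: linear_injective_0[OF linear_dnormed_Psi])
  then obtain r where "r > 0" and r: "inj_on normed_Psi (ball (U, \<Gamma>) r)"
    by (rule normed_Psi_locally_inj)
  show "locally_identifiable (U, \<Gamma>)"
  proof (rule locally_identifiable_if_inj_on)
    show "openin (top_of_set factorizations) (factorizations \<inter> ball (U, \<Gamma>) r)"
      by (simp add: openin_open_Int)
    show "(U, \<Gamma>) \<in> factorizations \<inter> ball (U, \<Gamma>) r"
      using unit \<open>r > 0\<close> by (simp add: factorizations_def)
    \<comment> \<open>With unit atoms the appended components all equal 1, so equal values of
      \<open>Psi\<close> force equal values of \<open>normed_Psi\<close>.\<close>
    have normed_Psi_eq: "normed_Psi x = (Psi x, \<chi> j. 1)" if "x \<in> factorizations" for x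
      using that by (auto simp: normed_Psi_def factorizations_def vec_eq_iff dot_square_norm)
    show "inj_on Psi (factorizations \<inter> ball (U, \<Gamma>) r)"
    proof (rule inj_onI)
      fix x y
      assume x: "x \<in> factorizations \<inter> ball (U, \<Gamma>) r"
        and y: "y \<in> factorizations \<inter> ball (U, \<Gamma>) r" and "Psi x = Psi y"
      then have "normed_Psi x = normed_Psi y"
        by (simp only: normed_Psi_eq Int_iff)
      with r x y show "x = y"
        by (simp only: inj_on_def Int_iff)
    qed
  qed
qed

end
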